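(* On the round unit sphere $(\mathbb{S}^2,g)$ there exists a function $f\in C^2(\mathbb{S}^2)$ such that $\nabla^2 f\le g$ everywhere on $\mathbb{S}^2$ but $f$ is not $c$-concave with respect to the cost $c(x,y)=\frac12 d^2(x,y)$.
   Context: $d$ is the Riemannian distance on $\mathbb{S}^2$, $\nabla^2 f$ the Riemannian Hessian, and inequalities between symmetric $2$-tensors are in the sense of quadratic forms at every point. A function $f:\mathbb{S}^2\to\mathbb{R}$ is $c$-concave (for $c=\frac12 d^2$) if there is a family $(x_i,a_i)_{i\in I}\subseteq \mathbb{S}^2\times\mathbb{R}$ such that $f(x)=\inf_{i\in I}\left(\frac12 d^2(x,x_i)-a_i\right)$ for all $x\in \mathbb{S}^2$. *)

theory Defs
  imports "HOL-Analysis.Analysis"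
begin

text \<open>
  The round unit sphere is the Riemannian submanifold \<open>S2\<close> of \<open>real^3\<close>: its metric is the
  restriction of the inner product to the tangent planes.  Functions and vector fields on it are
  rendered as functions on \<open>real^3\<close>; nothing below depends on their values off \<open>S2\<close>.
\<close>

definition S2 :: "(real^3) set" where
  "S2 = sphere 0 1"

definition tangent_plane :: "real^3 \<Rightarrow> (real^3) set" where
  "tangent_plane x = {v. v \<bullet> x = 0}"

definition tangent_proj :: "real^3 \<Rightarrow> real^3 \<Rightarrow> real^3" where
  "tangent_proj x w = w - (w \<bullet> x) *\<^sub>R x"


text \<open>
  A \<open>valid_path\<close> may have unbounded velocity near a break point, and hence infinite length.
  Using \<open>has_integral\<close> leaves such curves out, whereas \<open>integral\<close> would give them length 0.
\<close>

definition has_curve_length :: "(real \<Rightarrow> real^3) \<Rightarrow> real \<Rightarrow> bool" where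
  "has_curve_length \<gamma> L \<longleftrightarrow>
     ((\<lambda>t. norm (vector_derivative \<gamma> (at t))) has_integral L) {0..1}"

definition S2_dist :: "real^3 \<Rightarrow> real^3 \<Rightarrow> real" where
  "S2_dist x y = Inf {L. \<exists>\<gamma>. valid_path \<gamma> \<and> path_image \<gamma> \<subseteq> S2 \<and>
                             pathstart \<gamma> = x \<and> pathfinish \<gamma> = y \<and> has_curve_length \<gamma> L}"


definition C2_on_open :: "(real^3) set \<Rightarrow> (real^3 \<Rightarrow> real) \<Rightarrow> bool" where
  "C2_on_open U F \<longleftrightarrow>
     (\<exists>(F' :: real^3 \<Rightarrow> (real^3) \<Rightarrow>\<^sub>L real) (F'' :: real^3 \<Rightarrow> (real^3) \<Rightarrow>\<^sub>L ((real^3) \<Rightarrow>\<^sub>L real)).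
        (\<forall>x\<in>U. (F has_derivative blinfun_apply (F' x)) (at x)) \<and>
        (\<forall>x\<in>U. (F' has_derivative blinfun_apply (F'' x)) (at x)) \<and>
        continuous_on U F'')"

text \<open>Differentiability class on an embedded submanifold: local \<open>C\<^sup>2\<close> extensions exist.\<close>

definition C2_on_S2 :: "(real^3 \<Rightarrow> real) \<Rightarrow> bool" where
  "C2_on_S2 f \<longleftrightarrow>
     (\<forall>p\<in>S2. \<exists>U F. open U \<and> p \<in> U \<and> C2_on_open U F \<and> (\<forall>x\<in>S2 \<inter> U. F x = f x))"


text \<open>
  A Frechet derivative at \<open>x\<close> within \<open>S2\<close> is determined only on \<open>tangent_plane x\<close>; its value on
  the normal direction is arbitrary.  All uses below are on tangent vectors.
\<close>

definition S2_grad :: "(real^3 \<Rightarrow> real) \<Rightarrow> real^3 \<Rightarrow> real^3" where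
  "S2_grad f x = (THE w. w \<in> tangent_plane x \<and>
     (\<forall>v\<in>tangent_plane x. w \<bullet> v = frechet_derivative f (at x within S2) v))"

text \<open>
  The Levi-Civita connection of the induced metric is the tangential part of the ambient
  derivative (Gauss formula).
\<close>

definition S2_covariant_derivative ::
    "(real^3 \<Rightarrow> real^3) \<Rightarrow> real^3 \<Rightarrow> real^3 \<Rightarrow> real^3" where
  "S2_covariant_derivative Z x v = tangent_proj x (frechet_derivative Z (at x within S2) v)"

definition S2_Hessian :: "(real^3 \<Rightarrow> real) \<Rightarrow> real^3 \<Rightarrow> real^3 \<Rightarrow> real^3 \<Rightarrow> real" where
  "S2_Hessian f x u v = S2_covariant_derivative (S2_grad f) x u \<bullet> v"


text \<open>
  The set \<open>A\<close> is the range of the family \<open>(x\<^sub>i, a\<^sub>i)\<close>.  The infimum is taken in \<open>ereal\<close>, since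
  \<open>Inf\<close> on \<open>real\<close> has an unspecified value on empty sets and on sets unbounded below.
\<close>

definition c_concave :: "(real^3 \<Rightarrow> real) \<Rightarrow> bool" where
  "c_concave f \<longleftrightarrow>
     (\<exists>A \<subseteq> S2 \<times> (UNIV :: real set).
        \<forall>x\<in>S2. ereal (f x) = (INF (y, a)\<in>A. ereal ((S2_dist x y)\<^sup>2 / 2 - a)))"

end

theory Submission imports Defs begin

text \<open>
  At distance \<open>\<theta> \<in> (0, \<pi>)\<close> from \<open>y\<close> the Hessian of \<open>d(\<cdot>, y)\<^sup>2 / 2\<close> is \<open>\<theta> cot \<theta> < 1\<close> in the direction
  orthogonal to the gradient.  A function that has transverse second derivative \<open>1\<close> at a point
  where its gradient does not vanish is therefore not touched from above there by any
  \<open>d(\<cdot>, y)\<^sup>2 / 2 - a\<close>.  The cubic \<open>z\<^sup>2 / 2 - r x - r x z\<^sup>2 / 2\<close> has Hessian exactly \<open>1\<close> in the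
  direction of \<open>z\<close> along the whole equator \<open>z = 0\<close>, and for \<open>r = 1/4\<close> the bound \<open>\<nabla>\<^sup>2 f \<le> g\<close> holds on all
  of the sphere.  Its gradient at \<open>(0, 1, 0)\<close> has length \<open>r\<close>.
\<close>

section \<open>The spherical distance\<close>

lemma great_circle_in_S2:
  assumes "x \<in> S2" "w \<in> S2" "w \<bullet> x = 0"
  shows "cos t *\<^sub>R x + sin t *\<^sub>R w \<in> S2"
proof -
  have "x \<bullet> x = 1" "w \<bullet> w = 1" "x \<bullet> w = 0"
    using assms by (auto simp: S2_def dot_square_norm inner_commute)
  then have "(norm (cos t *\<^sub>R x + sin t *\<^sub>R w))\<^sup>2 = 1"
    using assms(3) unfolding power2_norm_eq_inner
    by (simp add: inner_add_left inner_add_right flip: power2_eq_square)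
  then show ?thesis
    unfolding S2_def using power2_eq_1_iff
    by (metis dist_0_norm mem_sphere norm_ge_zero not_one_le_zero neg_0_le_iff_le)
qed

text \<open>Gram-Schmidt: \<open>w\<close> is the normalised component of \<open>y\<close>
  orthogonal to \<open>x\<close>. When that component vanishes, so does the sine, and any unit
  vector orthogonal to \<open>x\<close> serves.\<close>

lemma exists_orthogonal_unit_on_great_circle:
  assumes "x \<in> S2" "y \<in> S2"
  obtains w where "w \<in> S2" "w \<bullet> x = 0"
    "y = cos (arccos (x \<bullet> y)) *\<^sub>R x + sin (arccos (x \<bullet> y)) *\<^sub>R w"
proof -
  define c where "c = x \<bullet> y"
  define z where "z = y - c *\<^sub>R x"
  have xx: "x \<bullet> x = 1" and yy: "y \<bullet> y = 1"
    using assms by (auto simp: S2_def dot_square_norm)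
  have c1: "\<bar>c\<bar> \<le> 1"
    unfolding c_def using Cauchy_Schwarz_ineq2[of x y] assms by (auto simp: S2_def)
  have zx: "z \<bullet> x = 0"
    by (simp add: z_def inner_diff_left xx c_def inner_commute[of y])
  have zz: "z \<bullet> z = 1 - c\<^sup>2"
    by (simp add: z_def inner_diff_left inner_diff_right xx yy inner_commute
        flip: c_def) (simp add: c_def inner_commute power2_eq_square)
  have cosc: "cos (arccos c) = c" using c1 by (simp add: cos_arccos_abs)
  have sinc: "sin (arccos c) = norm z"
    using c1 zz by (simp add: sin_arccos_abs norm_eq_sqrt_inner)
  show thesis
  proof (cases "z = 0")
    case True
    obtain w where "w \<noteq> 0" "orthogonal w x"
      using orthogonal_to_vector_exists[of x] by (auto simp: orthogonal_commute)
    then have "w /\<^sub>R norm w \<in> S2" "(w /\<^sub>R norm w) \<bullet> x = 0"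
      by (auto simp: S2_def orthogonal_def)
    moreover have "y = c *\<^sub>R x" using True by (simp add: z_def)
    ultimately show thesis
      using that[of "w /\<^sub>R norm w"] cosc sinc True by (simp add: c_def)
  next
    case False
    then have "z /\<^sub>R norm z \<in> S2" "(z /\<^sub>R norm z) \<bullet> x = 0"
      using zx by (auto simp: S2_def)
    moreover have "y = c *\<^sub>R x + norm z *\<^sub>R (z /\<^sub>R norm z)"
      using False by (simp add: z_def)
    ultimately show thesis
      using that[of "z /\<^sub>R norm z"] cosc sinc by (simp add: c_def)
  qed
qed

lemma exists_great_circle_path:
  assumes "x \<in> S2" "y \<in> S2"
  obtains \<gamma> where "valid_path \<gamma>" "path_image \<gamma> \<subseteq> S2" "pathstart \<gamma> = x" "pathfinish \<gamma> = y"
    "has_curve_length \<gamma> (arccos (x \<bullet> y))"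
proof -
  define \<theta> where "\<theta> = arccos (x \<bullet> y)"
  obtain w where w: "w \<in> S2" "w \<bullet> x = 0" "y = cos \<theta> *\<^sub>R x + sin \<theta> *\<^sub>R w"
    using exists_orthogonal_unit_on_great_circle[OF assms] unfolding \<theta>_def by blast
  have "0 \<le> \<theta>"
    unfolding \<theta>_def using Cauchy_Schwarz_ineq2[of x y] assms
    by (intro arccos_lbound) (auto simp: S2_def)
  define \<gamma> where "\<gamma> t = cos (\<theta> * t) *\<^sub>R x + sin (\<theta> * t) *\<^sub>R w" for t
  define \<gamma>' where "\<gamma>' t = \<theta> *\<^sub>R (- sin (\<theta> * t) *\<^sub>R x + cos (\<theta> * t) *\<^sub>R w)" for t
  have deriv: "(\<gamma> has_vector_derivative \<gamma>' t) (at t)" for t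
    unfolding \<gamma>_def \<gamma>'_def
    by (auto intro!: derivative_eq_intros simp: algebra_simps)
  have "continuous_on {0..1} \<gamma>'"
    unfolding \<gamma>'_def by (intro continuous_intros)
  then have "valid_path \<gamma>"
    using deriv unfolding valid_path_def
    by (intro C1_differentiable_imp_piecewise) (auto simp: C1_differentiable_on_def)
  moreover have "path_image \<gamma> \<subseteq> S2"
    using great_circle_in_S2[OF assms(1) w(1,2)] by (auto simp: path_image_def \<gamma>_def)
  moreover have "pathstart \<gamma> = x" "pathfinish \<gamma> = y"
    using w by (auto simp: pathstart_def pathfinish_def \<gamma>_def)
  moreover have "norm (\<gamma>' t) = \<theta>" for t
  proof -
    \<comment> \<open>Up to the factor \<open>\<theta>\<close>, the velocity is the point of the
      same great circle a quarter turn ahead, hence a unit vector.\<close>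
    have "- sin (\<theta> * t) *\<^sub>R x + cos (\<theta> * t) *\<^sub>R w \<in> S2"
      using great_circle_in_S2[OF assms(1) w(1,2), of "\<theta> * t + pi / 2"]
      by (simp add: cos_add sin_add)
    then have "norm (- sin (\<theta> * t) *\<^sub>R x + cos (\<theta> * t) *\<^sub>R w) = 1"
      by (simp add: S2_def)
    then show ?thesis
      using \<open>0 \<le> \<theta>\<close> unfolding \<gamma>'_def by simp
  qed
  then have "has_curve_length \<gamma> \<theta>"
    using has_integral_const_real[of \<theta> 0 1]
    by (simp add: has_curve_length_def vector_derivative_at[OF deriv])
  ultimately show thesis
    using that unfolding \<theta>_def by blast
qed

text \<open>
  The factor \<open>l < 1\<close> keeps the argument of \<open>arccos\<close> away from \<open>\<plusminus>1\<close>, so that the angle to the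
  starting point becomes differentiable without losing the bound by the speed; then \<open>l \<rightarrow> 1\<close>.
\<close>

lemma arccos_le_curve_length:
  assumes "valid_path \<gamma>" "path_image \<gamma> \<subseteq> S2" "has_curve_length \<gamma> L"
  shows "arccos (pathstart \<gamma> \<bullet> pathfinish \<gamma>) \<le> L"
proof -
  define x where "x = \<gamma> 0"
  define u where "u t = x \<bullet> \<gamma> t" for t
  have S: "norm (\<gamma> t) = 1" if "t \<in> {0..1}" for t
    using assms(2) that by (auto simp: path_image_def S2_def image_subset_iff)
  have nx: "norm x = 1" unfolding x_def by (rule S) simp
  have u1: "\<bar>u t\<bar> \<le> 1" if "t \<in> {0..1}" for t
    using Cauchy_Schwarz_ineq2[of x "\<gamma> t"] S[OF that] nx by (simp add: u_def)
  obtain S0 where "finite S0" and C1: "\<gamma> C1_differentiable_on ({0..1} - S0)"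
    and cont: "continuous_on {0..1} \<gamma>"
    using assms(1) by (auto simp: valid_path_def piecewise_C1_differentiable_on_def)
  have bound: "arccos (l * u 1) - arccos l \<le> L" if l: "0 < l" "l < 1" for l
  proof -
    \<comment> \<open>The derivative of the damped angle \<open>arccos (l * u t)\<close>, by the
      chain rule.\<close>
    define d where "d t = - (l * (x \<bullet> vector_derivative \<gamma> (at t))) / sqrt (1 - (l * u t)\<^sup>2)" for t
    have lu: "\<bar>l * u t\<bar> < 1" if "t \<in> {0..1}" for t
    proof -
      have "\<bar>l * u t\<bar> = l * \<bar>u t\<bar>" using l by (simp add: abs_mult)
      also have "\<dots> \<le> l * 1" using u1[OF that] l by (intro mult_left_mono) auto
      finally show ?thesis using l by simp
    qed
    have contl: "continuous_on {0..1} (\<lambda>t. arccos (l * u t))"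
    proof (intro continuous_on_arccos)
      show "continuous_on {0..1} (\<lambda>t. l * u t)"
        unfolding u_def by (intro continuous_intros cont)
      show "\<forall>t\<in>{0..1}. - 1 \<le> l * u t \<and> l * u t \<le> 1"
        using lu by (smt (verit))
    qed
    have der: "((\<lambda>t. arccos (l * u t)) has_vector_derivative d t) (at t)"
      and dle: "d t \<le> norm (vector_derivative \<gamma> (at t))"
      if t: "t \<in> {0<..<1} - S0" for t
    proof -
      define v where "v = vector_derivative \<gamma> (at t)"
      have t01: "t \<in> {0..1}" using t by auto
      have "\<gamma> differentiable at t"
        using C1 t by (auto simp: C1_differentiable_on_eq)
      then have v: "(\<gamma> has_vector_derivative v) (at t)"
        unfolding v_def by (simp add: vector_derivative_works)
      have u': "(u has_real_derivative x \<bullet> v) (at t)"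
        unfolding u_def using v
        by (auto simp: has_real_derivative_iff_has_vector_derivative
            intro: bounded_linear.has_vector_derivative[OF bounded_linear_inner_right])
      have "((\<lambda>t. arccos (l * u t)) has_real_derivative d t) (at t)"
        unfolding d_def v_def[symmetric]
        using lu[OF t01] by (auto intro!: derivative_eq_intros u' simp: divide_inverse)
      then show "((\<lambda>t. arccos (l * u t)) has_vector_derivative d t) (at t)"
        by (simp add: has_real_derivative_iff_has_vector_derivative)
      have "((\<lambda>s. \<gamma> s \<bullet> \<gamma> s) has_real_derivative 2 * (\<gamma> t \<bullet> v)) (at t)"
        using v unfolding has_vector_derivative_def has_field_derivative_def
        by (auto intro!: derivative_eq_intros simp: fun_eq_iff inner_commute algebra_simps)
      \<comment> \<open>The curve has norm 1 throughout a neighbourhood of an interior time, so its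
        velocity is orthogonal to its position.\<close>
      moreover have "((\<lambda>s. \<gamma> s \<bullet> \<gamma> s) has_real_derivative 0) (at t)"
      proof (rule DERIV_cong_ev[THEN iffD1, OF refl _ refl DERIV_const])
        have "\<forall>\<^sub>F s in nhds t. s \<in> {0<..<1}"
          using t by (intro eventually_nhds_in_open) auto
        then show "\<forall>\<^sub>F s in nhds t. 1 = \<gamma> s \<bullet> \<gamma> s"
          by eventually_elim (simp add: dot_square_norm S)
      qed
      ultimately have gv: "\<gamma> t \<bullet> v = 0"
        using DERIV_unique by fastforce
      have "(x \<bullet> v)\<^sup>2 \<le> (1 - (u t)\<^sup>2) * (norm v)\<^sup>2"
      proof -
        \<comment> \<open>As \<open>v\<close> is orthogonal to \<open>\<gamma> t\<close>, only the
          component of \<open>x\<close> orthogonal to \<open>\<gamma> t\<close> contributes. Its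
          squared length \<open>1 - (u t)\<^sup>2\<close> sharpens Cauchy-Schwarz enough to offset
          the square root in \<open>d\<close>.\<close>
        have "x \<bullet> v = (x - u t *\<^sub>R \<gamma> t) \<bullet> v" using gv by (simp add: inner_diff_left)
        then have "(x \<bullet> v)\<^sup>2 \<le> ((x - u t *\<^sub>R \<gamma> t) \<bullet> (x - u t *\<^sub>R \<gamma> t)) * (v \<bullet> v)"
          by (metis Cauchy_Schwarz_ineq)
        also have "(x - u t *\<^sub>R \<gamma> t) \<bullet> (x - u t *\<^sub>R \<gamma> t) = 1 - (u t)\<^sup>2"
        proof -
          have "x \<bullet> x = 1" "\<gamma> t \<bullet> \<gamma> t = 1"
            using nx S[OF t01] by (simp_all add: dot_square_norm)
          then show ?thesis
            by (simp add: inner_diff_left inner_diff_right inner_commute[of "\<gamma> t" x] u_def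
                power2_eq_square)
        qed
        finally show ?thesis by (simp add: dot_square_norm)
      qed
      then have "l\<^sup>2 * (x \<bullet> v)\<^sup>2 \<le> l\<^sup>2 * ((1 - (u t)\<^sup>2) * (norm v)\<^sup>2)"
        by (intro mult_left_mono) auto
      also have "\<dots> = (l\<^sup>2 - (l * u t)\<^sup>2) * (norm v)\<^sup>2"
        by (simp add: algebra_simps power_mult_distrib)
      also have "\<dots> \<le> (1 - (l * u t)\<^sup>2) * (norm v)\<^sup>2"
        using l by (intro mult_right_mono) (auto simp: power_le_one)
      finally have "(l * (x \<bullet> v))\<^sup>2 \<le> (1 - (l * u t)\<^sup>2) * (norm v)\<^sup>2"
        by (simp add: power_mult_distrib)
      then have "\<bar>l * (x \<bullet> v)\<bar> \<le> sqrt ((1 - (l * u t)\<^sup>2) * (norm v)\<^sup>2)"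
        by (intro real_le_rsqrt) simp
      also have "\<dots> = sqrt (1 - (l * u t)\<^sup>2) * norm v"
        by (simp add: real_sqrt_mult)
      finally have "\<bar>l * (x \<bullet> v)\<bar> \<le> sqrt (1 - (l * u t)\<^sup>2) * norm v" .
      moreover have "sqrt (1 - (l * u t)\<^sup>2) > 0"
        using lu[OF t01] by (simp add: abs_square_less_1)
      ultimately show "d t \<le> norm (vector_derivative \<gamma> (at t))"
        unfolding d_def v_def[symmetric]
        by (subst pos_divide_le_eq) (linarith | simp add: mult.commute)+
    qed
    have int: "(d has_integral (arccos (l * u 1) - arccos (l * u 0))) {0..1}"
      using \<open>finite S0\<close> contl der
      by (intro fundamental_theorem_of_calculus_interior_strong[of S0]) auto
    \<comment> \<open>The speed is redefined on a finite set, which keeps its integral, so that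
      \<open>d t \<le> n t\<close> holds at every time of the interval.\<close>
    define n where "n t = (if t \<in> S0 \<union> {0, 1} then d t else norm (vector_derivative \<gamma> (at t)))" for t
    have "(n has_integral L) {0..1}"
      using assms(3) unfolding has_curve_length_def
      by (rule has_integral_spike_finite[rotated 2, where S = "S0 \<union> {0, 1}"])
        (use \<open>finite S0\<close> in \<open>auto simp: n_def\<close>)
    then have "arccos (l * u 1) - arccos (l * u 0) \<le> L"
      by (rule has_integral_le[OF int]) (use dle in \<open>auto simp: n_def\<close>)
    moreover have "u 0 = 1" using nx by (simp add: u_def x_def dot_square_norm)
    ultimately show ?thesis by simp
  qed
  have u11: "\<bar>u 1\<bar> \<le> 1" by (rule u1) simp
  \<comment> \<open>\<open>arccos\<close> is not differentiable at 1, but continuity up to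
    \<open>l = 1\<close> is enough to pass to the limit, where \<open>arccos l\<close> tends to
    0.\<close>
  have "continuous_on {0..1} (\<lambda>l. arccos (l * u 1) - arccos l)"
  proof (intro continuous_intros ballI)
    fix l :: real assume "l \<in> {0..1}"
    then have "\<bar>l * u 1\<bar> \<le> 1" using u11 by (simp add: abs_mult mult_le_one)
    then show "- 1 \<le> l * u 1 \<and> l * u 1 \<le> 1" by linarith
  qed auto
  then have "((\<lambda>l. arccos (l * u 1) - arccos l) \<longlongrightarrow> arccos (1 * u 1) - arccos 1) (at_left 1)"
    unfolding continuous_on at_within_Icc_at_left[OF zero_less_one, symmetric]
    by (rule bspec) simp
  moreover have "\<forall>\<^sub>F l in at_left 1. arccos (l * u 1) - arccos l \<le> L"
    using bound eventually_at_left_real[of 0 "1::real"] by (auto elim: eventually_mono)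
  ultimately have "arccos (1 * u 1) - arccos 1 \<le> L"
    by (rule tendsto_upperbound) simp
  then show ?thesis by (simp add: u_def x_def pathstart_def pathfinish_def)
qed

lemma S2_dist_eq_arccos:
  assumes "x \<in> S2" "y \<in> S2"
  shows "S2_dist x y = arccos (x \<bullet> y)"
  unfolding S2_dist_def
proof (rule cInf_eq_minimum)
  show "arccos (x \<bullet> y) \<in> {L. \<exists>\<gamma>. valid_path \<gamma> \<and> path_image \<gamma> \<subseteq> S2 \<and>
      pathstart \<gamma> = x \<and> pathfinish \<gamma> = y \<and> has_curve_length \<gamma> L}"
    using exists_great_circle_path[OF assms] by blast
qed (use arccos_le_curve_length in blast)

section \<open>The Hessian of the restriction of an ambient function\<close>

text \<open>Composing \<open>h\<close> with the great circle leaving \<open>x\<close> in the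
  direction of \<open>v\<close> turns any derivative within \<open>S2\<close> into an ordinary
  derivative in one real variable, which is unique.\<close>

lemma derivative_within_S2_unique:
  fixes h :: "real^3 \<Rightarrow> 'a::real_normed_vector"
  assumes x: "x \<in> S2" and v: "v \<in> tangent_plane x"
    and A: "(h has_derivative A) (at x within S2)"
    and B: "(h has_derivative B) (at x within S2)"
  shows "A v = B v"
proof (cases "v = 0")
  case True
  then show ?thesis
    using A B by (simp add: has_derivative_bounded_linear linear_simps(3))
next
  case False
  define w where "w = v /\<^sub>R norm v"
  have w: "w \<in> S2" "w \<bullet> x = 0"
    using False v by (auto simp: w_def S2_def tangent_plane_def)
  define \<gamma> where "\<gamma> t = cos t *\<^sub>R x + sin t *\<^sub>R w" for t
  have \<gamma>0: "\<gamma> 0 = x" by (simp add: \<gamma>_def)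
  have range: "range \<gamma> \<subseteq> S2"
    using great_circle_in_S2[OF x w] by (auto simp: \<gamma>_def)
  have \<gamma>: "(\<gamma> has_vector_derivative w) (at 0)"
    unfolding \<gamma>_def by (auto intro!: derivative_eq_intros)
  have *: "((h \<circ> \<gamma>) has_vector_derivative D w) (at 0)"
    if "(h has_derivative D) (at x within S2)" for D
  proof -
    have "(h has_derivative D) (at (\<gamma> 0) within range \<gamma>)"
      using that range unfolding \<gamma>0 by (rule has_derivative_subset)
    then show ?thesis
      using vector_derivative_diff_chain_within[of \<gamma> w 0 UNIV h D] \<gamma> by simp
  qed
  have "A w = B w"
    using *[OF A] *[OF B] by (rule vector_derivative_unique_at)
  moreover have "v = norm v *\<^sub>R w" using False by (simp add: w_def)
  ultimately show ?thesis
    using A B by (metis has_derivative_bounded_linear linear_simps(5))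
qed

text \<open>\<open>frechet_derivative\<close> is some derivative picked by choice; on tangent
  vectors all candidates agree, so any known one computes it.\<close>

lemma frechet_derivative_within_S2:
  fixes h :: "real^3 \<Rightarrow> 'a::real_normed_vector"
  assumes "x \<in> S2" "v \<in> tangent_plane x" "(h has_derivative A) (at x within S2)"
  shows "frechet_derivative h (at x within S2) v = A v"
  using assms derivative_within_S2_unique[OF assms(1,2) _ assms(3)]
  by (meson differentiableI frechet_derivative_works)

lemma tangent_proj_in_tangent_plane: "x \<in> S2 \<Longrightarrow> tangent_proj x w \<in> tangent_plane x"
  by (simp add: tangent_proj_def tangent_plane_def S2_def inner_diff_left dot_square_norm)

lemma tangent_proj_inner: "v \<in> tangent_plane x \<Longrightarrow> tangent_proj x w \<bullet> v = w \<bullet> v"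
  by (simp add: tangent_proj_def tangent_plane_def inner_diff_left inner_commute[of x])

lemma S2_grad_eq:
  assumes x: "x \<in> S2" and F: "(F has_derivative (\<lambda>v. g \<bullet> v)) (at x)"
  shows "S2_grad F x = tangent_proj x g"
  unfolding S2_grad_def
proof (rule the_equality)
  have fd: "frechet_derivative F (at x within S2) v = g \<bullet> v" if "v \<in> tangent_plane x" for v
    using frechet_derivative_within_S2[OF x that has_derivative_at_withinI[OF F]] .
  show "tangent_proj x g \<in> tangent_plane x \<and>
      (\<forall>v\<in>tangent_plane x. tangent_proj x g \<bullet> v = frechet_derivative F (at x within S2) v)"
    using x by (simp add: fd tangent_proj_in_tangent_plane tangent_proj_inner)
  fix w assume w: "w \<in> tangent_plane x \<and>
      (\<forall>v\<in>tangent_plane x. w \<bullet> v = frechet_derivative F (at x within S2) v)"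
  \<comment> \<open>The difference of two candidates is itself tangent, so it can be tested against
    itself.\<close>
  define e where "e = w - tangent_proj x g"
  have e: "e \<in> tangent_plane x"
    using w tangent_proj_in_tangent_plane[OF x, of g]
    by (simp add: e_def tangent_plane_def inner_diff_left)
  then have "e \<bullet> e = 0"
    using w by (simp add: fd tangent_proj_inner e_def[THEN arg_cong, of "\<lambda>z. z \<bullet> e"]
        inner_diff_left)
  then show "w = tangent_proj x g" by (simp add: e_def)
qed

text \<open>Removing the normal part of \<open>g\<close> before differentiating produces multiples
  of \<open>x\<close>, which a tangent \<open>v\<close> does not see, and the term
  \<open>(g x \<bullet> x) * (u \<bullet> v)\<close>, which is the contribution of the second
  fundamental form of the sphere.\<close>

lemma S2_Hessian_eq:
  assumes x: "x \<in> S2" and u: "u \<in> tangent_plane x" and v: "v \<in> tangent_plane x"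
    and F: "\<And>p. (F has_derivative (\<lambda>v. g p \<bullet> v)) (at p)"
    and g: "(g has_derivative Dg) (at x)"
  shows "S2_Hessian F x u v = Dg u \<bullet> v - (g x \<bullet> x) * (u \<bullet> v)"
proof -
  have "((\<lambda>p. tangent_proj p (g p)) has_derivative
      (\<lambda>v. Dg v - ((g x \<bullet> v + Dg v \<bullet> x) *\<^sub>R x + (g x \<bullet> x) *\<^sub>R v))) (at x within S2)"
    unfolding tangent_proj_def
    using has_derivative_at_withinI[OF g]
    by (auto intro!: derivative_eq_intros simp: fun_eq_iff algebra_simps)
  \<comment> \<open>The two fields agree on \<open>S2\<close>, and the derivative within
    \<open>S2\<close> depends only on the values there.\<close>
  then have "(S2_grad F has_derivative
      (\<lambda>v. Dg v - ((g x \<bullet> v + Dg v \<bullet> x) *\<^sub>R x + (g x \<bullet> x) *\<^sub>R v))) (at x within S2)"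
    by (rule has_derivative_transform[OF x, rotated]) (simp add: S2_grad_eq[OF _ F])
  then show ?thesis
    unfolding S2_Hessian_def S2_covariant_derivative_def tangent_proj_inner[OF v]
    by (subst frechet_derivative_within_S2[OF x u])
      (use v in \<open>auto simp: tangent_plane_def inner_diff_left inner_add_left inner_commute[of x]\<close>)
qed

section \<open>Touching cost functions of \<open>c\<close>-concave functions\<close>

text \<open>The infimum at \<open>x\<close> need not be attained by the family. Near-minimisers with
  error \<open>1 / Suc n\<close> exist, and subtracting the bounds at \<open>q\<close> and at
  \<open>x\<close> eliminates the constants \<open>a\<close>. Only the points of \<open>S2\<close>
  remain, and by compactness they subconverge to a point whose cost touches \<open>f\<close>
  exactly.\<close>

lemma c_concave_touching:
  assumes c: "c_concave f" and x: "x \<in> S2"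
  obtains y where "y \<in> S2"
    "\<And>q. q \<in> S2 \<Longrightarrow> f q - f x \<le> ((arccos (q \<bullet> y))\<^sup>2 - (arccos (x \<bullet> y))\<^sup>2) / 2"
proof -
  obtain A where A: "A \<subseteq> S2 \<times> (UNIV::real set)"
    and inf: "\<And>x. x \<in> S2 \<Longrightarrow> ereal (f x) = (INF (y, a)\<in>A. ereal ((S2_dist x y)\<^sup>2 / 2 - a))"
    using c unfolding c_concave_def by blast
  have "\<exists>y\<in>S2. \<forall>q\<in>S2.
      f q - f x \<le> ((arccos (q \<bullet> y))\<^sup>2 - (arccos (x \<bullet> y))\<^sup>2) / 2 + 1 / Suc n" for n
  proof -
    have "(INF (y, a)\<in>A. ereal ((S2_dist x y)\<^sup>2 / 2 - a)) < ereal (f x + 1 / Suc n)"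
      using inf[OF x] by (metis ereal_less_eq(3) not_le add_le_same_cancel1 of_nat_0_less_iff
          zero_less_Suc zero_less_divide_1_iff)
    then obtain y a where ya: "(y, a) \<in> A" and lt: "(S2_dist x y)\<^sup>2 / 2 - a < f x + 1 / Suc n"
      by (auto simp: INF_less_iff)
    then have y: "y \<in> S2" using A by auto
    have "f q \<le> (S2_dist q y)\<^sup>2 / 2 - a" if "q \<in> S2" for q
    proof -
      have "ereal (f q) \<le> ereal ((S2_dist q y)\<^sup>2 / 2 - a)"
        unfolding inf[OF that] by (rule INF_lower2[OF ya]) simp
      then show ?thesis by simp
    qed
    then show ?thesis
      using lt y x
      by (intro bexI[of _ y] ballI)
        (smt (verit) S2_dist_eq_arccos field_sum_of_halves diff_divide_distrib)+
  qed
  then obtain Y where Y: "\<And>n. Y n \<in> S2" and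
    Yle: "\<And>n q. q \<in> S2 \<Longrightarrow>
      f q - f x \<le> ((arccos (q \<bullet> Y n))\<^sup>2 - (arccos (x \<bullet> Y n))\<^sup>2) / 2 + 1 / Suc n"
    by metis
  have "compact S2" by (simp add: S2_def)
  then obtain y r where y: "y \<in> S2" and r: "strict_mono r" and lim: "(Y \<circ> r) \<longlonglongrightarrow> y"
    using Y unfolding compact_def by blast
  have arc: "(\<lambda>n. arccos (q \<bullet> Y (r n))) \<longlonglongrightarrow> arccos (q \<bullet> y)" if "q \<in> S2" for q
  proof -
    have "continuous_on S2 (\<lambda>y. arccos (q \<bullet> y))"
    proof (intro continuous_intros ballI)
      fix z assume "z \<in> S2"
      then show "- 1 \<le> q \<bullet> z \<and> q \<bullet> z \<le> 1"
        using Cauchy_Schwarz_ineq2[of q z] that by (auto simp: S2_def)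
    qed
    from continuous_on_tendsto_compose[OF this lim y] show ?thesis
      using Y by (simp add: o_def)
  qed
  have "f q - f x \<le> ((arccos (q \<bullet> y))\<^sup>2 - (arccos (x \<bullet> y))\<^sup>2) / 2 + 0" if q: "q \<in> S2" for q
  proof (rule LIMSEQ_le_const)
    show "(\<lambda>n. ((arccos (q \<bullet> Y (r n)))\<^sup>2 - (arccos (x \<bullet> Y (r n)))\<^sup>2) / 2 + 1 / Suc (r n))
        \<longlonglongrightarrow> ((arccos (q \<bullet> y))\<^sup>2 - (arccos (x \<bullet> y))\<^sup>2) / 2 + 0"
      using LIMSEQ_subseq_LIMSEQ[OF LIMSEQ_inverse_real_of_nat r, unfolded o_def inverse_eq_divide]
      by (intro tendsto_intros arc q x) simp_all
    show "\<exists>N. \<forall>n\<ge>N. f q - f x \<le>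
        ((arccos (q \<bullet> Y (r n)))\<^sup>2 - (arccos (x \<bullet> Y (r n)))\<^sup>2) / 2 + 1 / Suc (r n)"
      using Yle[OF q] by blast
  qed
  with y that show thesis by force
qed

section \<open>The counterexample\<close>

text \<open>The restriction of \<open>- x / 4\<close> has Hessian \<open>x / 4\<close> times the
  metric, so without the cubic term the transverse second derivative on the equator would be
  \<open>1 + x / 4\<close>. The cubic term subtracts \<open>x / 4\<close> again.\<close>

definition witness :: "real^3 \<Rightarrow> real" where
  "witness p = (p$3)\<^sup>2 / 2 - p$1 / 4 - p$1 * (p$3)\<^sup>2 / 8"

definition witness_grad :: "real^3 \<Rightarrow> real^3" where
  "witness_grad p = (- 1/4 - (p$3)\<^sup>2 / 8) *\<^sub>R axis 1 1 + (p$3 - p$1 * p$3 / 4) *\<^sub>R axis 3 1"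

definition witness_grad_deriv :: "real^3 \<Rightarrow> real^3 \<Rightarrow> real^3" where
  "witness_grad_deriv p v = (- (p$3 * v$3) / 4) *\<^sub>R axis 1 1 +
     (v$3 - (p$1 * v$3 + v$1 * p$3) / 4) *\<^sub>R axis 3 1"

lemmas has_derivative_vec_nth = bounded_linear.has_derivative[OF bounded_linear_vec_nth]

lemma witness_has_derivative: "(witness has_derivative (\<lambda>v. witness_grad p \<bullet> v)) (at p)"
  unfolding witness_def witness_grad_def
  by (auto intro!: derivative_eq_intros has_derivative_vec_nth
      simp: fun_eq_iff inner_add_left inner_axis' power2_eq_square algebra_simps)

lemma witness_grad_has_derivative: "(witness_grad has_derivative witness_grad_deriv p) (at p)"
  unfolding witness_grad_def witness_grad_deriv_def
  by (auto intro!: derivative_eq_intros has_derivative_vec_nth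
      simp: fun_eq_iff power2_eq_square algebra_simps)

lemma C2_on_open_witness: "C2_on_open UNIV witness"
proof -
  define E where "E i = blinfun_inner_left (axis i 1 :: real^3)" for i :: 3
  have E: "blinfun_apply (E i) v = v$i" for i v
    by (simp add: E_def inner_axis inner_axis')
  \<comment> \<open>The tensor products of the coordinate forms \<open>E i\<close>, a basis in which
    the second derivative has polynomial, hence continuous, coefficients.\<close>
  define T where "T i j = Blinfun (\<lambda>v. blinfun_apply (E i) v *\<^sub>R E j)" for i j
  have T: "blinfun_apply (T i j) v = v$i *\<^sub>R E j" for i j v
    unfolding T_def
    by (subst bounded_linear_Blinfun_apply) (auto intro!: bounded_linear_intros simp: E)
  define F' where "F' p = (- 1/4 - (p$3)\<^sup>2 / 8) *\<^sub>R E 1 + (p$3 - p$1 * p$3 / 4) *\<^sub>R E 3"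
    for p :: "real^3"
  define F'' where "F'' p = (- (p$3) / 4) *\<^sub>R T 3 1 + (1 - p$1 / 4) *\<^sub>R T 3 3 - (p$3 / 4) *\<^sub>R T 1 3"
    for p :: "real^3"
  have "blinfun_apply (F' p) = (\<lambda>v. witness_grad p \<bullet> v)" for p
    by (auto simp: fun_eq_iff F'_def witness_grad_def blinfun.bilinear_simps E
        inner_add_left inner_axis')
  then have "(witness has_derivative blinfun_apply (F' p)) (at p)" for p
    using witness_has_derivative by simp
  moreover have "(F' has_derivative blinfun_apply (F'' p)) (at p)" for p
    unfolding F'_def
    by (auto intro!: derivative_eq_intros has_derivative_vec_nth
        simp: F''_def blinfun.bilinear_simps T fun_eq_iff power2_eq_square
          add_divide_distrib algebra_simps)
  moreover have "continuous_on UNIV F''"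
    unfolding F''_def by (intro continuous_intros) auto
  ultimately show ?thesis unfolding C2_on_open_def by blast
qed

lemma S2_Hessian_witness_le:
  assumes p: "p \<in> S2" and v: "v \<in> tangent_plane p"
  shows "S2_Hessian witness p v v \<le> v \<bullet> v"
proof -
  define x z a b c where "x = p$1" and "z = p$3" and "a = v$1" and "b = v$2" and "c = v$3"
  have "\<bar>x\<bar> \<le> 1" using component_le_norm_cart[of p 1] p by (simp add: x_def S2_def)
  then have x: "x \<le> 1" by simp
  have vv: "v \<bullet> v = a\<^sup>2 + b\<^sup>2 + c\<^sup>2"
    by (simp add: inner_vec_def sum_3 a_def b_def c_def power2_eq_square)
  have "witness_grad_deriv p v \<bullet> v = (1 - x / 4) * c\<^sup>2 - z * a * c / 2"
    by (simp add: witness_grad_deriv_def inner_add_left inner_axis' x_def z_def a_def c_def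
        power2_eq_square algebra_simps)
  moreover have "witness_grad p \<bullet> p = z\<^sup>2 - x / 4 - 3 / 8 * x * z\<^sup>2"
    by (simp add: witness_grad_def inner_add_left inner_axis' x_def z_def
        power2_eq_square algebra_simps)
  ultimately have "v \<bullet> v - S2_Hessian witness p v v =
      v \<bullet> v - ((1 - x / 4) * c\<^sup>2 - z * a * c / 2 - (z\<^sup>2 - x / 4 - 3 / 8 * x * z\<^sup>2) * (v \<bullet> v))"
    by (simp add: S2_Hessian_eq[OF p v v witness_has_derivative witness_grad_has_derivative])
  \<comment> \<open>A polynomial identity with every summand nonnegative for
    \<open>x \<le> 1\<close>. The mixed term \<open>z * a * c / 2\<close> is absorbed by the square
    of \<open>a + z * c\<close>; at \<open>z = 0\<close> no \<open>c\<^sup>2\<close> is left, which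
    is the equality case on the equator.\<close>
  also have "\<dots> = (1 - x) / 4 * (a\<^sup>2 + b\<^sup>2) + 3 / 4 * b\<^sup>2 + (3 / 8 * (1 - x) + 5 / 8) * z\<^sup>2 * (a\<^sup>2 + b\<^sup>2)
      + 3 / 8 * (1 - x) * z\<^sup>2 * c\<^sup>2 + (1 / 2 * a\<^sup>2 + 3 / 8 * (z * c)\<^sup>2 + 1 / 4 * (a + z * c)\<^sup>2)"
    unfolding vv by (simp add: power2_eq_square field_simps)
  also have "\<dots> \<ge> 0"
    using x by (intro add_nonneg_nonneg mult_nonneg_nonneg) auto
  finally show ?thesis by simp
qed

text \<open>This is \<open>t cot t < 1\<close> cleared of its denominator. The difference of the two
  sides vanishes at 0 and has derivative \<open>s * sin s > 0\<close>.\<close>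

lemma mult_cos_less_sin:
  assumes "0 < t" "t < pi"
  shows "t * cos t < sin t"
proof -
  have "(\<lambda>t. sin t - t * cos t) 0 < (\<lambda>t. sin t - t * cos t) t"
  proof (rule DERIV_pos_imp_increasing_open[OF assms(1)])
    fix s :: real assume "0 < s" "s < t"
    then have "0 < s * sin s" using assms by (intro mult_pos_pos sin_gt_zero) auto
    moreover have "((\<lambda>t. sin t - t * cos t) has_real_derivative s * sin s) (at s)"
      by (auto intro!: derivative_eq_intros)
    ultimately show "\<exists>y. ((\<lambda>t. sin t - t * cos t) has_real_derivative y) (at s) \<and> 0 < y"
      by blast
  qed (intro continuous_intros)
  then show ?thesis by simp
qed

text \<open>Comparing \<open>(0, 1, 0)\<close> with suitable points first forces \<open>y\<close>
  onto the equator with \<open>0 < b < 1\<close>. The meridian \<open>u = 0\<close> is then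
  orthogonal to the direction of \<open>y\<close>, and the strict second-order comparison along it
  gives the contradiction.\<close>

lemma not_c_concave_witness: "\<not> c_concave witness"
proof
  assume cc: "c_concave witness"
  let ?p = "vector [0, 1, 0] :: real^3"
  have S2_iff: "q \<in> S2 \<longleftrightarrow> (q$1)\<^sup>2 + (q$2)\<^sup>2 + (q$3)\<^sup>2 = 1" for q
    by (simp add: S2_def norm_eq_sqrt_inner inner_vec_def sum_3 power2_eq_square)
  have "?p \<in> S2" by (simp add: S2_iff)
  then obtain y where "y \<in> S2"
    and le0: "\<And>q. q \<in> S2 \<Longrightarrow>
      witness q - witness ?p \<le> ((arccos (q \<bullet> y))\<^sup>2 - (arccos (?p \<bullet> y))\<^sup>2) / 2"
    using c_concave_touching[OF cc] by blast
  define a b c where "a = y$1" and "b = y$2" and "c = y$3"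
  have abc: "a\<^sup>2 + b\<^sup>2 + c\<^sup>2 = 1"
    using \<open>y \<in> S2\<close> by (simp add: S2_iff a_def b_def c_def)
  define \<theta> where "\<theta> = arccos b"
  have le: "w\<^sup>2 / 2 - u / 4 - u * w\<^sup>2 / 8 \<le> ((arccos (u * a + v * b + w * c))\<^sup>2 - \<theta>\<^sup>2) / 2"
    if "u\<^sup>2 + v\<^sup>2 + w\<^sup>2 = 1" for u v w
    using le0[of "vector [u, v, w]"] that
    by (simp add: S2_iff witness_def inner_vec_def sum_3 a_def b_def c_def \<theta>_def)
  have "b\<^sup>2 \<le> 1" using abc by (smt (verit) zero_le_power2)
  then have b1: "- 1 \<le> b" "b \<le> 1" by (auto simp: abs_square_le_1)
  have c0: "c = 0"
  proof (rule ccontr)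
    \<comment> \<open>The point of the circle \<open>{(0, *, *)}\<close> nearest to \<open>y\<close> is closer to \<open>y\<close> than \<open>(0, 1, 0)\<close>.\<close>
    assume c: "c \<noteq> 0"
    define n where "n = sqrt (b\<^sup>2 + c\<^sup>2)"
    have n2: "n\<^sup>2 = b\<^sup>2 + c\<^sup>2" by (simp add: n_def)
    have n: "n > 0" using c by (simp add: n_def sum_power2_gt_zero_iff)
    have "\<bar>b\<bar> < n" unfolding n_def using c by (intro real_less_rsqrt) simp
    have "n \<le> 1" unfolding n_def using abc by (smt (verit) real_sqrt_le_1_iff zero_le_power2)
    have "b / n * b + c / n * c = n"
      using n n2 by (simp add: field_simps power2_eq_square)
    then have le_n: "(c / n)\<^sup>2 / 2 \<le> ((arccos n)\<^sup>2 - \<theta>\<^sup>2) / 2"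
      using le[of 0 "b / n" "c / n"] n by (simp add: power_divide flip: add_divide_distrib n2)
    have "(arccos n)\<^sup>2 < \<theta>\<^sup>2"
      unfolding \<theta>_def using \<open>\<bar>b\<bar> < n\<close> \<open>n \<le> 1\<close> b1
      by (intro power_strict_mono arccos_less_arccos arccos_lbound) auto
    then have "((arccos n)\<^sup>2 - \<theta>\<^sup>2) / 2 < 0" by simp
    moreover have "0 \<le> (c / n)\<^sup>2 / 2" by simp
    ultimately show False using le_n by (meson not_less order_trans)
  qed
  \<comment> \<open>For \<open>b = 1\<close> the cost is centred at \<open>(0, 1, 0)\<close> itself
    and grows only quadratically, while \<open>witness\<close> grows linearly, as
    \<open>sin s / 4\<close>, along the equator towards negative first coordinate.\<close>
  have "b \<noteq> 1"
  proof
    assume "b = 1"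
    then have "a = 0" using abc c0 by simp
    have "((\<lambda>s. s\<^sup>2 / 2 - sin s / 4) has_real_derivative - 1/4) (at 0)"
      by (auto intro!: derivative_eq_intros)
    then obtain d :: real where d: "d > 0" "\<And>s::real. 0 < s \<Longrightarrow> s < d \<Longrightarrow> s\<^sup>2 / 2 - sin s / 4 < 0"
      using DERIV_neg_dec_right[of "\<lambda>s. s\<^sup>2 / 2 - sin s / 4" "- 1/4" 0] by auto
    \<comment> \<open>The cap at 1 keeps \<open>s \<le> pi\<close>, so that
      \<open>arccos (cos s) = s\<close>.\<close>
    define s where "s = min (d / 2) 1"
    have s: "0 < s" "s < d" "s \<le> pi" using d(1) pi_gt3 by (auto simp: s_def)
    then have "sin s / 4 \<le> s\<^sup>2 / 2"
      using le[of "- sin s" "cos s" 0] \<open>b = 1\<close> \<open>a = 0\<close> c0 by (simp add: \<theta>_def arccos_cos)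
    with d(2)[OF s(1,2)] show False by simp
  qed
  \<comment> \<open>With \<open>c = 0\<close> the north pole is at distance \<open>pi / 2\<close>
    from \<open>y\<close>. If \<open>b \<le> 0\<close>, the cost there is no larger than at
    \<open>(0, 1, 0)\<close>, yet \<open>witness\<close> rises by \<open>1/2\<close>. This also
    excludes the antipodal point, where the squared distance is not smooth.\<close>
  have "b > 0"
  proof (rule ccontr)
    assume "\<not> b > 0"
    then have "pi / 2 \<le> \<theta>"
      unfolding \<theta>_def using b1 arccos_le_arccos[of b 0] by simp
    then have "(pi / 2)\<^sup>2 \<le> \<theta>\<^sup>2" by (intro power_mono) auto
    then show False using le[of 0 0 1] c0 by simp
  qed
  have b: "0 < b" "b < 1" using \<open>b \<noteq> 1\<close> \<open>b > 0\<close> b1 by auto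
  have \<theta>: "0 < \<theta>" "\<theta> < pi" "cos \<theta> = b" "sin \<theta> = sqrt (1 - b\<^sup>2)"
    unfolding \<theta>_def using b arccos_lt_bounded[of b] by (auto simp: sin_arccos)
  \<comment> \<open>The parameter \<open>h = 1 - cos t\<close> along \<open>(0, cos t, sin t)\<close> turns the second-order condition
    at \<open>t = 0\<close> into a first-order one.\<close>
  define H where "H h = (arccos (b * (1 - h)))\<^sup>2 - (2 * h - h\<^sup>2)" for h
  \<comment> \<open>The derivative is \<open>2 * (\<theta> cot \<theta> - 1)\<close>, twice the gap
    between the transverse Hessians of the cost and of \<open>witness\<close>.\<close>
  have "(H has_real_derivative (2 * \<theta> * b / sin \<theta> - 2)) (at 0)"
    unfolding H_def using b
    by (auto intro!: derivative_eq_intros simp: \<theta>(4) divide_inverse simp flip: \<theta>_def)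
  moreover have "2 * \<theta> * b / sin \<theta> - 2 < 0"
    using mult_cos_less_sin[OF \<theta>(1,2)] sin_gt_zero[OF \<theta>(1,2)] \<theta>(3) by (simp add: field_simps)
  ultimately have "\<exists>d>0. \<forall>h>0. h < d \<longrightarrow> H (0 + h) < H 0"
    by (rule DERIV_neg_dec_right)
  then obtain d where d: "d > 0" "\<And>h. 0 < h \<Longrightarrow> h < d \<Longrightarrow> H h < H 0"
    by auto
  \<comment> \<open>\<open>h \<le> 1\<close> keeps \<open>2 * h - h\<^sup>2\<close> nonnegative, so
    that its square root \<open>w\<close> completes \<open>(0, 1 - h, w)\<close> to a point of the
    sphere.\<close>
  define h where "h = min (d / 2) 1"
  have h: "0 < h" "h < d" "h \<le> 1" using d(1) by (auto simp: h_def)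
  define w where "w = sqrt (2 * h - h\<^sup>2)"
  have w: "w\<^sup>2 = 2 * h - h\<^sup>2"
    unfolding w_def using h by (simp add: power2_eq_square mult_right_mono)
  have "0\<^sup>2 + (1 - h)\<^sup>2 + w\<^sup>2 = 1"
    unfolding w by (simp add: power2_eq_square algebra_simps)
  from le[OF this] have "w\<^sup>2 \<le> (arccos ((1 - h) * b))\<^sup>2 - \<theta>\<^sup>2"
    using c0 by simp
  then have "H 0 \<le> H h" by (simp add: H_def w \<theta>_def mult.commute)
  with d(2)[OF h(1,2)] show False by simp
qed

theorem mainTheorem3:
  "\<exists>f :: real^3 \<Rightarrow> real.
     C2_on_S2 f \<and>
     (\<forall>x\<in>S2. \<forall>v\<in>tangent_plane x. S2_Hessian f x v v \<le> v \<bullet> v) \<and>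
     \<not> c_concave f"
proof (intro exI conjI ballI)
  show "C2_on_S2 witness"
    unfolding C2_on_S2_def using C2_on_open_witness by blast
qed (use S2_Hessian_witness_le not_c_concave_witness in auto)

end
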